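(* Every 2-groups partitionable discrete Nash equilibrium problem whose feasible set $X$ is non-empty and bounded has at least one equilibrium.
   Context: There are $N$ players; player $\nu$ controls $x^\nu\in\mathbb{R}^{n_\nu}$; $n=n_1+\dots+n_N$, $\mathbf{x}=(x^1,\dots,x^N)=(x^\nu,\mathbf{x}^{-\nu})\in\mathbb{R}^n$, where $\mathbf{x}^{-\nu}$ collects the variables of all players other than $\nu$. $X=\prod_\nu X^\nu$ with $X^\nu\subseteq\mathbb{R}^{n_\nu}$ the feasible set of player $\nu$ before integrality. In the discrete Nash equilibrium problem (NEP) each player $\nu$ solves $\min_{x^\nu}\theta_\nu(x^\nu,\mathbf{x}^{-\nu})$ subject to $x^\nu\in X^\nu\cap\mathbb{Z}^{n_\nu}$, where $\theta_\nu:\mathbb{R}^n\to\mathbb{R}$. An equilibrium is a point $\mathbf{x}_*\in X\cap\mathbb{Z}^n$ such that for all $\nu$, $\theta_\nu(x^\nu_*,\mathbf{x}^{-\nu}_* )\le\theta_\nu(x^\nu,\mathbf{x}^{-\nu}_* )$ for all $x^\nu\in X^\nu\cap\mathbb{Z}^{n_\nu}$. Standing assumptions: each $\theta_\nu$ is continuously differentiable and is convex as a function of $x^\nu$ alone. $F^\nu(\mathbf{x}):=\nabla_{x^\nu}\theta_\nu(\mathbf{x})$, with components $F^\nu_i$; the partial derivatives of $F^\nu_i$ appearing below are assumed to exist. A discrete NEP is 2-groups partitionable if: (i) $X=\{\mathbf{x}\in\mathbb{R}^n : \mathbf{l}\le\mathbf{x}\le\mathbf{u}\}$ with $\mathbf{l},\mathbf{u}\in\mathbb{Z}^n$;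 (ii) for each player $\nu$, $\theta_\nu(x^\nu,\mathbf{x}^{-\nu})=\theta^P_\nu(x^\nu)+\Theta^O_\nu(\mathbf{x}^{-\nu})^T x^\nu$ with $\theta^P_\nu(x^\nu)=\sum_{i=1}^{n_\nu}\vartheta^P_{\nu,i}(x^\nu_i)+\frac12(x^\nu)^TQ^\nu x^\nu$, where $\vartheta^P_{\nu,i}:\mathbb{R}\to\mathbb{R}$ for all $i$, $Q^\nu$ is a real $n_\nu\times n_\nu$ matrix, and $\Theta^O_\nu:\mathbb{R}^{n-n_\nu}\to\mathbb{R}^{n_\nu}$ is an operator each of whose components is a convex function or a concave function; (iii) there is a partition of the set of variable indices $\{(\nu,i):1\le\nu\le N,\ 1\le i\le n_\nu\}$ into two groups $G_1,G_2$ such that for all $\mathbf{x}\in X$ and all $(\nu,i)\neq(\mu,j)$: $\frac{\partial F^\nu_i(\mathbf{x})}{\partial x^\mu_j}\le0$ if $(\nu,i)$ and $(\mu,j)$ belong to the same group, and $\frac{\partial F^\nu_i(\mathbf{x})}{\partial x^\mu_j}\ge0$ if they belong to different groups (one of the two groups may be empty). *)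

theory Defs
  imports "HOL-Analysis.Analysis"
begin

text \<open>
  The index type \<open>'k\<close> is the set of all scalar variables \<open>(\<nu>, i)\<close> and \<open>owner\<close> sends \<open>(\<nu>, i)\<close> to
  the player \<open>\<nu> :: 'p\<close>, so \<open>n = CARD('k)\<close>, \<open>N = CARD('p)\<close> and
  \<open>n\<^sub>\<nu> = card {k. owner k = \<nu>}\<close>. The spaces of dimensions \<open>n\<^sub>\<nu>\<close> and \<open>n - n\<^sub>\<nu>\<close> are identified with
  the coordinate subspaces \<open>own_space\<close> and \<open>others_space\<close> of \<open>real ^ 'k\<close>. Under this identification
  \<open>own owner \<nu> x\<close> is the block of player \<open>\<nu>\<close> in \<open>x\<close>, \<open>others owner \<nu> x\<close> collects the remaining
  blocks, and the pair of \<open>y \<in> own_space owner \<nu>\<close> and \<open>z \<in> others_space owner \<nu>\<close> is the sum \<open>y + z\<close>.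
\<close>

definition own_space :: "('k::finite \<Rightarrow> 'p::finite) \<Rightarrow> 'p \<Rightarrow> (real ^ 'k) set" where
  "own_space owner \<nu> = {y. \<forall>k. owner k \<noteq> \<nu> \<longrightarrow> y $ k = 0}"

definition others_space :: "('k::finite \<Rightarrow> 'p::finite) \<Rightarrow> 'p \<Rightarrow> (real ^ 'k) set" where
  "others_space owner \<nu> = {z. \<forall>k. owner k = \<nu> \<longrightarrow> z $ k = 0}"

definition own :: "('k::finite \<Rightarrow> 'p::finite) \<Rightarrow> 'p \<Rightarrow> real ^ 'k \<Rightarrow> real ^ 'k" where
  "own owner \<nu> x = (\<chi> k. if owner k = \<nu> then x $ k else 0)"

definition others :: "('k::finite \<Rightarrow> 'p::finite) \<Rightarrow> 'p \<Rightarrow> real ^ 'k \<Rightarrow> real ^ 'k" where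
  "others owner \<nu> x = (\<chi> k. if owner k = \<nu> then 0 else x $ k)"

lemma own_plus_others: "own owner \<nu> x + others owner \<nu> x = x"
  by (simp add: own_def others_def vec_eq_iff)

definition integral_points :: "(real ^ 'k::finite) set" where
  "integral_points = {x. \<forall>k. x $ k \<in> \<int>}"

definition joint_feasible ::
  "('k::finite \<Rightarrow> 'p::finite) \<Rightarrow> ('p \<Rightarrow> (real ^ 'k) set) \<Rightarrow> (real ^ 'k) set" where
  "joint_feasible owner X = {x. \<forall>\<nu>. own owner \<nu> x \<in> X \<nu>}"

definition partial_differentiable :: "(real ^ 'k::finite \<Rightarrow> real) \<Rightarrow> 'k \<Rightarrow> real ^ 'k \<Rightarrow> bool" where
  "partial_differentiable f k x \<longleftrightarrow> (\<lambda>t. f (x + t *\<^sub>R axis k 1)) field_differentiable (at 0)"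

definition partial_deriv :: "(real ^ 'k::finite \<Rightarrow> real) \<Rightarrow> 'k \<Rightarrow> real ^ 'k \<Rightarrow> real" where
  "partial_deriv f k x = deriv (\<lambda>t. f (x + t *\<^sub>R axis k 1)) 0"

definition continuously_differentiable :: "(real ^ 'k::finite \<Rightarrow> real) \<Rightarrow> bool" where
  "continuously_differentiable f \<longleftrightarrow>
     (\<exists>g. continuous_on UNIV g \<and> (\<forall>x. (f has_derivative (\<lambda>h. g x \<bullet> h)) (at x)))"

definition player_gradient ::
  "('k::finite \<Rightarrow> 'p::finite) \<Rightarrow> ('p \<Rightarrow> real ^ 'k \<Rightarrow> real) \<Rightarrow> 'p \<Rightarrow> real ^ 'k \<Rightarrow> real ^ 'k" where
  "player_gradient owner \<theta> \<nu> x =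
     (\<chi> k. if owner k = \<nu> then partial_deriv (\<theta> \<nu>) k x else 0)"

definition discrete_NEP ::
  "('k::finite \<Rightarrow> 'p::finite) \<Rightarrow> ('p \<Rightarrow> (real ^ 'k) set) \<Rightarrow> ('p \<Rightarrow> real ^ 'k \<Rightarrow> real) \<Rightarrow> bool" where
  "discrete_NEP owner X \<theta> \<longleftrightarrow>
     (\<forall>\<nu>. X \<nu> \<subseteq> own_space owner \<nu>) \<and>
     (\<forall>\<nu>. continuously_differentiable (\<theta> \<nu>)) \<and>
     (\<forall>\<nu>. \<forall>z \<in> others_space owner \<nu>. convex_on (own_space owner \<nu>) (\<lambda>y. \<theta> \<nu> (y + z)))"

definition equilibrium ::
  "('k::finite \<Rightarrow> 'p::finite) \<Rightarrow> ('p \<Rightarrow> (real ^ 'k) set) \<Rightarrow> ('p \<Rightarrow> real ^ 'k \<Rightarrow> real)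
     \<Rightarrow> real ^ 'k \<Rightarrow> bool" where
  "equilibrium owner X \<theta> x \<longleftrightarrow>
     x \<in> joint_feasible owner X \<inter> integral_points \<and>
     (\<forall>\<nu>. \<forall>y \<in> X \<nu> \<inter> integral_points.
        \<theta> \<nu> (own owner \<nu> x + others owner \<nu> x) \<le> \<theta> \<nu> (y + others owner \<nu> x))"

text \<open>
  The private part of the cost is evaluated at \<open>own owner \<nu> x\<close>, which vanishes outside the block of
  \<open>\<nu>\<close>. Hence only the diagonal block \<open>\<nu>\<close> of \<open>Q\<close> and the components \<open>k\<close> of \<open>\<Theta>\<close> with
  \<open>owner k = \<nu>\<close> contribute: \<open>Q\<close> encodes an \<open>n\<^sub>\<nu> \<times> n\<^sub>\<nu>\<close> matrix, and \<open>\<Theta>\<close> an operator from the space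
  of dimension \<open>n - n\<^sub>\<nu>\<close> to that of dimension \<open>n\<^sub>\<nu>\<close>.
\<close>

definition separable_cost ::
  "('k::finite \<Rightarrow> 'p::finite) \<Rightarrow> ('p \<Rightarrow> real ^ 'k \<Rightarrow> real) \<Rightarrow> 'p \<Rightarrow> bool" where
  "separable_cost owner \<theta> \<nu> \<longleftrightarrow>
     (\<exists>(\<phi> :: 'k \<Rightarrow> real \<Rightarrow> real) (Q :: real ^ 'k ^ 'k) (\<Theta> :: real ^ 'k \<Rightarrow> real ^ 'k).
        (\<forall>k. owner k = \<nu> \<longrightarrow>
           convex_on (others_space owner \<nu>) (\<lambda>z. \<Theta> z $ k) \<or>
           concave_on (others_space owner \<nu>) (\<lambda>z. \<Theta> z $ k)) \<and>
        (\<forall>x. \<theta> \<nu> x =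
           ((\<Sum>k | owner k = \<nu>. \<phi> k (own owner \<nu> x $ k))
             + 1 / 2 * (own owner \<nu> x \<bullet> (Q *v own owner \<nu> x)))
           + \<Theta> (others owner \<nu> x) \<bullet> own owner \<nu> x))"

text \<open>Existence of the mixed partial derivatives is demanded only where their sign is constrained.\<close>

definition sign_partition ::
  "('k::finite \<Rightarrow> 'p::finite) \<Rightarrow> ('p \<Rightarrow> (real ^ 'k) set) \<Rightarrow> ('p \<Rightarrow> real ^ 'k \<Rightarrow> real)
     \<Rightarrow> 'k set \<Rightarrow> 'k set \<Rightarrow> bool" where
  "sign_partition owner X \<theta> G1 G2 \<longleftrightarrow>
     G1 \<union> G2 = UNIV \<and> G1 \<inter> G2 = {} \<and>
     (\<forall>x \<in> joint_feasible owner X. \<forall>k l. k \<noteq> l \<longrightarrow>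
        (let F = (\<lambda>z. player_gradient owner \<theta> (owner k) z $ k) in
           partial_differentiable F l x \<and>
           ((k \<in> G1 \<and> l \<in> G1 \<or> k \<in> G2 \<and> l \<in> G2) \<longrightarrow> partial_deriv F l x \<le> 0) \<and>
           ((k \<in> G1 \<and> l \<in> G2 \<or> k \<in> G2 \<and> l \<in> G1) \<longrightarrow> partial_deriv F l x \<ge> 0)))"

definition two_groups_partitionable ::
  "('k::finite \<Rightarrow> 'p::finite) \<Rightarrow> ('p \<Rightarrow> (real ^ 'k) set) \<Rightarrow> ('p \<Rightarrow> real ^ 'k \<Rightarrow> real) \<Rightarrow> bool" where
  "two_groups_partitionable owner X \<theta> \<longleftrightarrow>
     (\<exists>l \<in> integral_points. \<exists>u \<in> integral_points.
        joint_feasible owner X = {x. \<forall>k. l $ k \<le> x $ k \<and> x $ k \<le> u $ k}) \<and>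
     (\<forall>\<nu>. separable_cost owner \<theta> \<nu>) \<and>
     (\<exists>G1 G2. sign_partition owner X \<theta> G1 G2)"

end

theory Submission
  imports Defs
begin

text \<open>
  Flipping the sign of the variables in one of the two groups turns all the sign conditions on the
  mixed partial derivatives into a single one: every mixed partial derivative of a cost
  \<open>\<theta> \<nu>\<close>, once in a variable of \<open>\<nu>\<close> and once in any other variable, is nonpositive on the box.
  Passing from these signs to finite differences (\<open>cross_difference_nonpos\<close>), the cost of \<open>\<nu>\<close> is
  submodular in the block of \<open>\<nu>\<close> and has decreasing differences between this block and the rest. So
  the game is supermodular: a player who faces larger strategies of the others has more reason to
  enlarge his own.

  The integral points of the box form a finite lattice, and on such a lattice a supermodular game
  has an equilibrium (\<open>supermodular_game_equilibrium\<close>). A point from which no player gains by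
  moving down exists, as any minimal point is one. If a player still gains at such a point, then
  he has a best response that lies above his present strategy, and moving up to it does not make
  downward moves attractive to anybody else, because the strategies that they face have only
  grown. Hence a maximal point of this kind is an equilibrium.
\<close>

section \<open>Equilibria of supermodular games on finite lattices\<close>

text \<open>
  The hypothesis on the costs is submodularity restricted to pairs \<open>a\<close>, \<open>b\<close> that are ordered
  outside the block of \<open>\<nu>\<close>. It combines submodularity in the own block with decreasing differences
  against the others: outside the block, \<open>inf a b\<close> agrees with \<open>a\<close> and \<open>sup a b\<close> with \<open>b\<close>.
\<close>

lemma supermodular_game_equilibrium:
  fixes owner :: "'k \<Rightarrow> 'p" and S :: "('k \<Rightarrow> 'a::lattice) set"
    and f :: "'p \<Rightarrow> ('k \<Rightarrow> 'a) \<Rightarrow> real"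
  assumes "finite S" and "S \<noteq> {}"
    and inf_closed: "\<And>a b. a \<in> S \<Longrightarrow> b \<in> S \<Longrightarrow> inf a b \<in> S"
    and sup_closed: "\<And>a b. a \<in> S \<Longrightarrow> b \<in> S \<Longrightarrow> sup a b \<in> S"
    and submod: "\<And>\<nu> a b. a \<in> S \<Longrightarrow> b \<in> S \<Longrightarrow> (\<And>k. owner k \<noteq> \<nu> \<Longrightarrow> a k \<le> b k) \<Longrightarrow>
                   f \<nu> (sup a b) + f \<nu> (inf a b) \<le> f \<nu> a + f \<nu> b"
  shows "\<exists>a\<in>S. \<forall>\<nu>. \<forall>b\<in>S. (\<forall>k. owner k \<noteq> \<nu> \<longrightarrow> b k = a k) \<longrightarrow> f \<nu> a \<le> f \<nu> b"
proof -
  define P where "P = {a \<in> S. \<forall>\<nu>. \<forall>b \<in> S.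
    b \<le> a \<longrightarrow> (\<forall>k. owner k \<noteq> \<nu> \<longrightarrow> b k = a k) \<longrightarrow> f \<nu> a \<le> f \<nu> b}"
  have "finite P"
    using \<open>finite S\<close> by (simp add: P_def)
  moreover have "P \<noteq> {}"
  proof -
    obtain m where "m \<in> S" "\<forall>b\<in>S. b \<le> m \<longrightarrow> m = b"
      using finite_has_minimal[OF \<open>finite S\<close> \<open>S \<noteq> {}\<close>] by blast
    then have "m \<in> P"
      by (auto simp: P_def)
    then show ?thesis by blast
  qed
  ultimately obtain a where "a \<in> P" and a_max: "\<And>b. b \<in> P \<Longrightarrow> a \<le> b \<Longrightarrow> a = b"
    using finite_has_maximal by metis
  then have "a \<in> S"
    and no_down: "\<And>\<nu> b. b \<in> S \<Longrightarrow> b \<le> a \<Longrightarrow> (\<And>k. owner k \<noteq> \<nu> \<Longrightarrow> b k = a k) \<Longrightarrow> f \<nu> a \<le> f \<nu> b"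
    by (auto simp: P_def)
  have "f \<nu> a \<le> f \<nu> b" if "b \<in> S" and "\<And>k. owner k \<noteq> \<nu> \<Longrightarrow> b k = a k" for \<nu> b
  proof -
    define D where "D = {c \<in> S. \<forall>k. owner k \<noteq> \<nu> \<longrightarrow> c k = a k}"
    have "finite D" "D \<noteq> {}"
      using \<open>finite S\<close> \<open>a \<in> S\<close> by (auto simp: D_def)
    then obtain z where "z \<in> D" and z_best: "\<And>c. c \<in> D \<Longrightarrow> f \<nu> z \<le> f \<nu> c"
      using arg_min_if_finite[of D "f \<nu>"] by (metis not_le)
    have "z \<in> S" and z_off: "\<And>k. owner k \<noteq> \<nu> \<Longrightarrow> z k = a k"
      using \<open>z \<in> D\<close> by (auto simp: D_def)
    \<comment> \<open>A best response need not lie above \<open>a\<close>, but its join with \<open>a\<close> does, and it is a best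
      response as well, because its meet with \<open>a\<close> is a downward move from \<open>a\<close>.\<close>
    define y where "y = sup a z"
    have "y \<in> S" and y_off: "\<And>k. owner k \<noteq> \<nu> \<Longrightarrow> y k = a k"
      using sup_closed[OF \<open>a \<in> S\<close> \<open>z \<in> S\<close>] z_off by (auto simp: y_def)
    have y_best: "f \<nu> y \<le> f \<nu> c" if "c \<in> D" for c
    proof -
      have "f \<nu> y + f \<nu> (inf a z) \<le> f \<nu> a + f \<nu> z"
        unfolding y_def using \<open>a \<in> S\<close> \<open>z \<in> S\<close> z_off by (intro submod) auto
      moreover have "f \<nu> a \<le> f \<nu> (inf a z)"
        using inf_closed[OF \<open>a \<in> S\<close> \<open>z \<in> S\<close>] z_off by (intro no_down) auto
      ultimately show ?thesis
        using z_best[OF that] by linarith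
    qed
    have "y \<in> P"
    proof -
      have "f \<mu> y \<le> f \<mu> w"
        if "w \<in> S" "w \<le> y" and w_off: "\<And>k. owner k \<noteq> \<mu> \<Longrightarrow> w k = y k" for \<mu> w
      proof (cases "\<mu> = \<nu>")
        case True
        then show ?thesis
          using y_best[of w] that y_off by (auto simp: D_def)
      next
        case False
        have a_le_y: "a k \<le> y k" for k
          by (simp add: y_def)
        have w_le: "w k \<le> a k" if "owner k = \<mu>" for k
          using le_funD[OF \<open>w \<le> y\<close>, of k] y_off[of k] that False by simp
        \<comment> \<open>A downward move of \<open>\<mu>\<close> from \<open>y\<close> to \<open>w\<close> is compared with the one from \<open>a\<close> to \<open>inf a w\<close>,
          made when the others play the smaller strategies in \<open>a\<close>.\<close>
        have "f \<mu> (sup a w) + f \<mu> (inf a w) \<le> f \<mu> a + f \<mu> w"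
          using \<open>a \<in> S\<close> \<open>w \<in> S\<close> w_off a_le_y by (intro submod) auto
        moreover have "f \<mu> a \<le> f \<mu> (inf a w)"
          using inf_closed[OF \<open>a \<in> S\<close> \<open>w \<in> S\<close>] w_off a_le_y
          by (intro no_down) (auto simp: inf.absorb1)
        moreover have "sup a w = y"
        proof
          fix k
          show "sup a w k = y k"
            using w_off[of k] a_le_y[of k] w_le[of k] y_off[of k] False
            by (cases "owner k = \<mu>") (auto simp: sup.absorb1 sup.absorb2)
        qed
        ultimately show ?thesis by simp
      qed
      then show ?thesis
        using \<open>y \<in> S\<close> by (auto simp: P_def)
    qed
    then have "a = y"
      using a_max by (simp add: y_def)
    then show ?thesis
      using y_best[of b] that by (simp add: D_def)
  qed
  with \<open>a \<in> S\<close> show ?thesis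
    by blast
qed

section \<open>Signs of partial derivatives and differences on a box\<close>

lemma partial_differentiable_DERIV:
  assumes "partial_differentiable f j (x + t *\<^sub>R axis j 1)"
  shows "((\<lambda>t. f (x + t *\<^sub>R axis j 1)) has_real_derivative
           partial_deriv f j (x + t *\<^sub>R axis j 1)) (at t)"
proof -
  have "((\<lambda>r. f (x + (r + t) *\<^sub>R axis j 1)) has_real_derivative
           partial_deriv f j (x + t *\<^sub>R axis j 1)) (at 0)"
    using field_differentiable_derivI[OF assms[unfolded partial_differentiable_def]]
    by (simp add: partial_deriv_def scaleR_add_left add_ac)
  then show ?thesis
    by (simp add: DERIV_shift[of "\<lambda>t. f (x + t *\<^sub>R axis j 1)" _ 0 t, simplified])
qed

text \<open>
  Only partial derivatives are available, so the path from \<open>x\<close> to \<open>y\<close> changes one coordinate at a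
  time; it stays in the box. The factor \<open>c\<close> lets the lemma serve for both monotonicities.
\<close>

lemma partial_deriv_sign_imp_le:
  fixes f :: "real ^ 'k::finite \<Rightarrow> real"
  assumes "x \<in> cbox l u" and "y \<in> cbox l u"
    and diff: "\<And>j z. z \<in> cbox l u \<Longrightarrow> x $ j \<noteq> y $ j \<Longrightarrow> partial_differentiable f j z"
    and sign: "\<And>j z. z \<in> cbox l u \<Longrightarrow> x $ j \<noteq> y $ j \<Longrightarrow>
                 c * (y $ j - x $ j) * partial_deriv f j z \<le> 0"
  shows "c * f y \<le> c * f x"
proof -
  define p where "p A = (\<chi> j. if j \<in> A then y $ j else x $ j)" for A
  have "c * f (p A) \<le> c * f x" if "finite A" for A
    using that
  proof induction
    case empty
    then show ?case by (simp add: p_def)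
  next
    case (insert j A)
    define h where "h = y $ j - x $ j"
    have p_ins: "p (insert j A) = p A + h *\<^sub>R axis j 1"
      using insert.hyps by (auto simp: p_def h_def vec_eq_iff axis_def)
    have "c * f (p (insert j A)) \<le> c * f (p A)"
    proof (cases "x $ j = y $ j")
      case True
      then show ?thesis by (simp add: p_ins h_def)
    next
      case False
      have in_box: "p A + (t * h) *\<^sub>R axis j 1 \<in> cbox l u" if "0 \<le> t" "t \<le> 1" for t
      proof -
        have "l $ j \<le> (1 - t) * x $ j + t * y $ j" "(1 - t) * x $ j + t * y $ j \<le> u $ j"
          using assms(1,2) that convex_bound_le[of "x $ j" "u $ j" "y $ j" "1 - t" t]
            convex_bound_le[of "- x $ j" "- l $ j" "- y $ j" "1 - t" t]
          by (auto simp: mem_box_cart)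
        then show ?thesis
          using assms(1,2) insert.hyps
          by (auto simp: mem_box_cart p_def axis_def h_def algebra_simps)
      qed
      have "((\<lambda>t. c * f (p A + (t * h) *\<^sub>R axis j 1)) has_real_derivative
              c * (partial_deriv f j (p A + (t * h) *\<^sub>R axis j 1) * h)) (at t)"
        if "0 \<le> t" "t \<le> 1" for t
        by (intro DERIV_cmult DERIV_chain2[where g = "\<lambda>t. t * h"] partial_differentiable_DERIV
            diff in_box that False) (auto intro!: derivative_eq_intros)
      moreover have "c * (partial_deriv f j (p A + (t * h) *\<^sub>R axis j 1) * h) \<le> 0"
        if "0 \<le> t" "t \<le> 1" for t
        using sign[OF in_box[OF that] False] by (simp add: h_def mult_ac)
      ultimately have "c * f (p A + (1 * h) *\<^sub>R axis j 1) \<le> c * f (p A + (0 * h) *\<^sub>R axis j 1)"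
        by (intro DERIV_nonpos_imp_nonincreasing[of 0 1]) fastforce+
      then show ?thesis by (simp add: p_ins)
    qed
    with insert.IH show ?case by simp
  qed
  from this[of UNIV] show ?thesis
    by (simp add: p_def)
qed

text \<open>
  Along the segment from \<open>w\<close> to \<open>w + d\<close> the gain of \<open>f\<close> accumulates at the rate
  \<open>\<Sum>k. d $ k * \<partial>\<^sub>k f\<close>, and by the sign condition no summand increases when the segment is
  translated by \<open>e\<close>. As \<open>d\<close> and \<open>e\<close> have disjoint supports, pure second derivatives do not occur in
  this comparison, and both segments lie in the box as soon as \<open>w\<close> and \<open>w + d + e\<close> do.
\<close>

lemma cross_difference_nonpos:
  fixes f :: "real ^ 'k::finite \<Rightarrow> real"
  assumes "continuously_differentiable f"
    and "w \<in> cbox l u" and "w + d + e \<in> cbox l u"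
    and disjoint: "\<And>k. d $ k = 0 \<or> e $ k = 0"
    and diff: "\<And>j k x. x \<in> cbox l u \<Longrightarrow> d $ k \<noteq> 0 \<Longrightarrow> e $ j \<noteq> 0 \<Longrightarrow>
                 partial_differentiable (partial_deriv f k) j x"
    and sign: "\<And>j k x. x \<in> cbox l u \<Longrightarrow> d $ k \<noteq> 0 \<Longrightarrow> e $ j \<noteq> 0 \<Longrightarrow>
                 d $ k * e $ j * partial_deriv (partial_deriv f k) j x \<le> 0"
  shows "f (w + d + e) + f w \<le> f (w + d) + f (w + e)"
proof -
  obtain g where g: "\<And>x. (f has_derivative (\<lambda>h. g x \<bullet> h)) (at x)"
    using assms(1) unfolding continuously_differentiable_def by blast
  have line: "((\<lambda>t. f (x + t *\<^sub>R v)) has_real_derivative g (x + t *\<^sub>R v) \<bullet> v) (at t)" for x v t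
  proof -
    have "((\<lambda>t. f (x + t *\<^sub>R v)) has_derivative (\<lambda>r. g (x + t *\<^sub>R v) \<bullet> (r *\<^sub>R v))) (at t)"
      by (rule has_derivative_compose[OF _ g]) (auto intro!: derivative_eq_intros)
    then show ?thesis
      by (simp add: has_field_derivative_def mult.commute[of _ "_ \<bullet> _"])
  qed
  have g_partial: "g x $ k = partial_deriv f k x" for x k
    using DERIV_imp_deriv[OF line[of x "axis k 1" 0]]
    by (simp add: partial_deriv_def inner_axis)
  have in_box: "w + t *\<^sub>R d \<in> cbox l u" "w + e + t *\<^sub>R d \<in> cbox l u" if "0 \<le> t" "t \<le> 1" for t
  proof -
    have bounds: "l $ k \<le> w $ k" "w $ k \<le> u $ k"
      "l $ k \<le> w $ k + d $ k + e $ k" "w $ k + d $ k + e $ k \<le> u $ k" for k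
      using assms(2,3) by (simp_all add: mem_box_cart)
    have "l $ k \<le> w $ k + t * d $ k \<and> w $ k + t * d $ k \<le> u $ k" if "e $ k = 0" for k
    proof -
      have "l $ k \<le> w $ k" "w $ k \<le> u $ k" "l $ k \<le> w $ k + d $ k" "w $ k + d $ k \<le> u $ k"
        using bounds[of k] that by auto
      then show ?thesis
        using \<open>0 \<le> t\<close> \<open>t \<le> 1\<close> convex_bound_le[of "w $ k" "u $ k" "w $ k + d $ k" "1 - t" t]
          convex_bound_le[of "- w $ k" "- l $ k" "- w $ k - d $ k" "1 - t" t]
        by (simp add: algebra_simps)
    qed
    moreover have "l $ k \<le> w $ k" "w $ k \<le> u $ k"
      "d $ k = 0 \<Longrightarrow> l $ k \<le> w $ k + e $ k" "d $ k = 0 \<Longrightarrow> w $ k + e $ k \<le> u $ k" for k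
      using bounds[of k] by auto
    ultimately have "l $ k \<le> w $ k + t * d $ k \<and> w $ k + t * d $ k \<le> u $ k \<and>
        l $ k \<le> w $ k + e $ k + t * d $ k \<and> w $ k + e $ k + t * d $ k \<le> u $ k" for k
      using disjoint[of k] by (cases "d $ k = 0") auto
    then show "w + t *\<^sub>R d \<in> cbox l u" "w + e + t *\<^sub>R d \<in> cbox l u"
      by (auto simp: mem_box_cart)
  qed
  have "(g (w + e + t *\<^sub>R d) - g (w + t *\<^sub>R d)) \<bullet> d \<le> 0" if "0 \<le> t" "t \<le> 1" for t
  proof -
    have "d $ k * g (w + e + t *\<^sub>R d) $ k \<le> d $ k * g (w + t *\<^sub>R d) $ k" for k
    proof (cases "d $ k = 0")
      case False
      show ?thesis
        unfolding g_partial
      proof (rule partial_deriv_sign_imp_le[OF in_box[OF that]])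
        fix j z assume "z \<in> cbox l u" and "(w + t *\<^sub>R d) $ j \<noteq> (w + e + t *\<^sub>R d) $ j"
        then show "partial_differentiable (partial_deriv f k) j z"
          and "d $ k * ((w + e + t *\<^sub>R d) $ j - (w + t *\<^sub>R d) $ j)
                 * partial_deriv (partial_deriv f k) j z \<le> 0"
          using diff[of z k j] sign[of z k j] False by simp_all
      qed
    qed simp
    then show ?thesis
      by (auto simp: inner_vec_def algebra_simps intro!: sum_nonpos)
  qed
  then have "\<exists>m. ((\<lambda>t. f (w + e + t *\<^sub>R d) - f (w + t *\<^sub>R d)) has_real_derivative m) (at t) \<and> m \<le> 0"
    if "0 \<le> t" "t \<le> 1" for t
    using that by (intro exI[of _ "g (w + e + t *\<^sub>R d) \<bullet> d - g (w + t *\<^sub>R d) \<bullet> d"] conjI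
        DERIV_diff line) (simp add: inner_diff_left)
  from DERIV_nonpos_imp_nonincreasing[OF zero_le_one this]
  have "f (w + e + d) - f (w + d) \<le> f (w + e) - f w"
    by simp
  then show ?thesis
    by (simp add: algebra_simps)
qed

section \<open>Existence of equilibria\<close>

theorem corollary4p6:
  fixes owner :: "'k::finite \<Rightarrow> 'p::finite"
    and X :: "'p \<Rightarrow> (real ^ 'k) set"
    and \<theta> :: "'p \<Rightarrow> real ^ 'k \<Rightarrow> real"
  assumes "discrete_NEP owner X \<theta>"
    and "two_groups_partitionable owner X \<theta>"
    and "joint_feasible owner X \<noteq> {}"
    and "bounded (joint_feasible owner X)"
  shows "\<exists>x. equilibrium owner X \<theta> x"
proof -
  obtain l u G1 G2 where l: "l \<in> integral_points"
    and box: "joint_feasible owner X = cbox l u"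
    and part: "sign_partition owner X \<theta> G1 G2"
    using assms(2) unfolding two_groups_partitionable_def
    by (auto simp: set_eq_iff mem_box_cart)
  have groups: "G1 \<union> G2 = UNIV" "G1 \<inter> G2 = {}"
    using part by (auto simp: sign_partition_def)
  define s :: "'k \<Rightarrow> real" where "s k = (if k \<in> G1 then 1 else - 1)" for k
  have ss: "s k * s k = 1" "s k * (s k * r) = r" for k r
    by (auto simp: s_def)
  have F: "(\<lambda>z. player_gradient owner \<theta> (owner k) z $ k) = partial_deriv (\<theta> (owner k)) k" for k
    by (simp add: player_gradient_def)
  have mixed: "partial_differentiable (partial_deriv (\<theta> (owner k)) k) j x"
    "s k * s j * partial_deriv (partial_deriv (\<theta> (owner k)) k) j x \<le> 0"
    if "x \<in> cbox l u" "k \<noteq> j" for k j x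
    using part that groups unfolding sign_partition_def box F Let_def s_def
    by (auto simp: set_eq_iff)
  \<comment> \<open>\<open>R\<close> translates from the flipped coordinates, in which all mixed derivatives are nonpositive
    and the order of the game is the pointwise one, back to \<open>\<real>\<^sup>n\<close>.\<close>
  define R :: "('k \<Rightarrow> real) \<Rightarrow> real ^ 'k" where "R a = (\<chi> k. s k * a k)" for a
  define S where "S = {a. R a \<in> cbox l u \<inter> integral_points}"
  have s_Ints: "s k * r \<in> \<int> \<longleftrightarrow> r \<in> \<int>" for k r
    by (simp add: s_def)
  have S_iff: "a \<in> S \<longleftrightarrow> (\<forall>k. a k \<in> {r \<in> \<int>. l $ k \<le> s k * r \<and> s k * r \<le> u $ k})" for a
    by (auto simp: S_def R_def mem_box_cart integral_points_def s_Ints)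
  have "finite S"
  proof -
    have "finite {r \<in> \<int>. l $ k \<le> s k * r \<and> s k * r \<le> u $ k}" for k
    proof (rule finite_subset[OF _ finite_int_segment])
      show "{r \<in> \<int>. l $ k \<le> s k * r \<and> s k * r \<le> u $ k}
          \<subseteq> {r \<in> \<int>. min (l $ k) (- u $ k) \<le> r \<and> r \<le> max (u $ k) (- l $ k)}"
        by (auto simp: s_def)
    qed
    then have "finite (PiE UNIV (\<lambda>k. {r \<in> \<int>. l $ k \<le> s k * r \<and> s k * r \<le> u $ k}))"
      by (intro finite_PiE) auto
    moreover have "S = PiE UNIV (\<lambda>k. {r \<in> \<int>. l $ k \<le> s k * r \<and> s k * r \<le> u $ k})"
      by (auto simp: S_iff PiE_UNIV_domain Pi_iff)
    ultimately show ?thesis by simp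
  qed
  have "S \<noteq> {}"
  proof -
    have "l \<in> cbox l u"
      using assms(3) by (auto simp: box mem_box_cart) (meson order_trans)
    moreover have "R (\<lambda>k. s k * l $ k) = l"
      by (simp add: R_def ss vec_eq_iff)
    ultimately have "(\<lambda>k. s k * l $ k) \<in> S"
      using l by (simp add: S_def)
    then show ?thesis by blast
  qed
  have lattice: "inf a b \<in> S" "sup a b \<in> S" if "a \<in> S" "b \<in> S" for a b
    using that unfolding S_iff by (auto simp: inf_min sup_max min_def max_def)
  have submod: "\<theta> \<nu> (R (sup a b)) + \<theta> \<nu> (R (inf a b)) \<le> \<theta> \<nu> (R a) + \<theta> \<nu> (R b)"
    if "a \<in> S" "b \<in> S" and le: "\<And>k. owner k \<noteq> \<nu> \<Longrightarrow> a k \<le> b k" for \<nu> a b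
  proof -
    have infS: "inf a b \<in> S" and supS: "sup a b \<in> S"
      using lattice that(1,2) by blast+
    \<comment> \<open>\<open>a\<close> and \<open>b\<close> exceed their meet in disjoint sets of coordinates, \<open>a\<close> only inside the block
      of \<open>\<nu>\<close>; so the mixed derivatives that enter are those of \<open>\<theta> \<nu>\<close> in a variable of \<open>\<nu>\<close>.\<close>
    define w where "w = R (inf a b)"
    define d where "d = R a - w"
    define e where "e = R b - w"
    have d: "d $ k = s k * (a k - min (a k) (b k))" for k
      by (simp add: d_def w_def R_def inf_min algebra_simps)
    have e: "e $ k = s k * (b k - min (a k) (b k))" for k
      by (simp add: e_def w_def R_def inf_min algebra_simps)
    have wde: "R (sup a b) = w + d + e"
      by (simp add: vec_eq_iff d e)
        (simp add: w_def R_def inf_min sup_max min_def max_def algebra_simps)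
    have owner_d: "owner k = \<nu>" if "d $ k \<noteq> 0" for k
      using that le[of k] by (auto simp: d min_def split: if_splits)
    have disj: "d $ k = 0 \<or> e $ k = 0" for k
      by (auto simp: d e min_def)
    have "\<theta> \<nu> (w + d + e) + \<theta> \<nu> w \<le> \<theta> \<nu> (w + d) + \<theta> \<nu> (w + e)"
    proof (rule cross_difference_nonpos)
      show "continuously_differentiable (\<theta> \<nu>)"
        using assms(1) by (simp add: discrete_NEP_def)
      show "w \<in> cbox l u" "w + d + e \<in> cbox l u"
        unfolding wde[symmetric] using infS supS by (simp_all add: S_def w_def)
      show "d $ k = 0 \<or> e $ k = 0" for k
        by (fact disj)
      fix j k x assume x: "x \<in> cbox l u" "d $ k \<noteq> 0" "e $ j \<noteq> 0"
      have "k \<noteq> j"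
        using disj x by metis
      note m = mixed[OF x(1) this, unfolded owner_d[OF x(2)]]
      show "partial_differentiable (partial_deriv (\<theta> \<nu>) k) j x"
        by (fact m(1))
      have "(a k - min (a k) (b k)) * (b j - min (a j) (b j))
              * (s k * s j * partial_deriv (partial_deriv (\<theta> \<nu>) k) j x) \<le> 0"
        by (intro mult_nonneg_nonpos m(2)) auto
      then show "d $ k * e $ j * partial_deriv (partial_deriv (\<theta> \<nu>) k) j x \<le> 0"
        by (simp add: d e mult_ac)
    qed
    then show ?thesis
      unfolding wde by (simp add: d_def e_def w_def)
  qed
  have "\<exists>a\<in>S. \<forall>\<nu>. \<forall>b\<in>S. (\<forall>k. owner k \<noteq> \<nu> \<longrightarrow> b k = a k) \<longrightarrow> \<theta> \<nu> (R a) \<le> \<theta> \<nu> (R b)"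
  proof (rule supermodular_game_equilibrium[where f = "\<lambda>\<nu> a. \<theta> \<nu> (R a)"])
    show "finite S" "S \<noteq> {}"
      by fact+
    show "inf a b \<in> S" "sup a b \<in> S" if "a \<in> S" "b \<in> S" for a b
      using lattice[OF that] by simp_all
    show "\<theta> \<nu> (R (sup a b)) + \<theta> \<nu> (R (inf a b)) \<le> \<theta> \<nu> (R a) + \<theta> \<nu> (R b)"
      if "a \<in> S" "b \<in> S" "\<And>k. owner k \<noteq> \<nu> \<Longrightarrow> a k \<le> b k" for \<nu> a b
      using that by (rule submod)
  qed
  then obtain a where "a \<in> S"
    and opt: "\<And>\<nu> b. b \<in> S \<Longrightarrow> \<forall>k. owner k \<noteq> \<nu> \<longrightarrow> b k = a k \<Longrightarrow> \<theta> \<nu> (R a) \<le> \<theta> \<nu> (R b)"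
    by metis
  define x where "x = R a"
  have x: "x \<in> joint_feasible owner X" "x \<in> integral_points"
    using \<open>a \<in> S\<close> by (auto simp: x_def S_def box)
  have "\<theta> \<nu> x \<le> \<theta> \<nu> (y + others owner \<nu> x)" if y: "y \<in> X \<nu>" "y \<in> integral_points" for \<nu> y
  proof -
    define v where "v = y + others owner \<nu> x"
    define b where "b k = s k * v $ k" for k
    have Rb: "R b = v"
      by (simp add: R_def b_def ss vec_eq_iff)
    have y_off: "y $ k = 0" if "owner k \<noteq> \<nu>" for k
      using assms(1) y that by (auto simp: discrete_NEP_def own_space_def)
    have "own owner \<mu> v = (if \<mu> = \<nu> then y else own owner \<mu> x)" for \<mu>
      by (auto simp: v_def own_def others_def vec_eq_iff y_off)
    then have "v \<in> joint_feasible owner X"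
      using x(1) y(1) by (simp add: joint_feasible_def)
    moreover have "v \<in> integral_points"
      using y(2) x(2) by (simp add: integral_points_def v_def others_def)
    ultimately have "b \<in> S"
      by (simp add: S_def Rb box)
    moreover have "b k = a k" if "owner k \<noteq> \<nu>" for k
      using that y_off[of k] by (simp add: b_def v_def others_def x_def R_def ss)
    ultimately show ?thesis
      using opt[of b \<nu>] unfolding Rb v_def x_def by blast
  qed
  then have "equilibrium owner X \<theta> x"
    using x by (auto simp: equilibrium_def own_plus_others)
  then show ?thesis ..
qed

end
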